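(* Let $T$ be a $\mathbb{Q}$-weighted tile made up of rectangles whose corners all have rational coordinates. Then $T$ $\mathbb{Q}$-shapetiles a square if and only if the weighted area of $T$ is not zero.
   Context: A rectangle is a product $[b_1,b_2)\times[c_1,c_2)\subset\mathbb{R}^2$ of half-open intervals with $b_1<b_2$ and $c_1<c_2$; a square is a rectangle with $b_2-b_1=c_2-c_1$. Let $A$ be a commutative ring with unity. An $A$-weighted tile is represented by a finite $A$-linear combination $a_1R_1+\cdots+a_nR_n$ of disjoint rectangles; to it is associated the function $\mathbb{R}^2\to A$ with value $a_i$ on $R_i$ and $0$ outside $\bigcup R_i$, and two combinations represent the same tile if and only if the associated functions are equal. Tiles are added and multiplied by elements of $A$ pointwise (as functions). An (unweighted) rectangle or square is regarded as a tile with weight $1$. For $A\subset\mathbb{R}$, the weighted area of $a_1R_1+\cdots+a_nR_n$ is $\sum_i a_i\,\mathrm{area}(R_i)$. A set $\{T_\lambda:\lambda\in\Lambda\}$ of $A$-weighted tiles $A$-tiles an $A$-weighted tile $U$ if there are finitely many weights $a_1,\dots,a_n\in A$ and tiles $\tilde T_1,\dots,\tilde T_n$, each a translation (by a vector in $\mathbb{R}^2$) of some $T_{\lambda_i}$, such that $a_1\tilde T_1+\cdots+a_n\tilde T_n=U$ (rotations and reflections are not allowed). For real $\rho>0$, $T(\rho)$ is the image of $T$ under the rescaling $(x,y)\mapsto(\rho x,\rho y)$. The tile $T$ $A$-shapetiles $U$ if $\{T(\rho):\rho\in\mathbb{R},\ \rho>0\}$ $A$-tiles $U$. *)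

theory Defs
  imports "HOL-Analysis.Analysis"
begin

type_synonym plane = "real \<times> real"

definition rectangle :: "plane set \<Rightarrow> bool" where
  "rectangle R \<longleftrightarrow>
     (\<exists>b1 b2 c1 c2. b1 < b2 \<and> c1 < c2 \<and> R = {b1..<b2} \<times> {c1..<c2})"

definition square :: "plane set \<Rightarrow> bool" where
  "square S \<longleftrightarrow>
     (\<exists>b1 b2 c1 c2. b1 < b2 \<and> c1 < c2 \<and> b2 - b1 = c2 - c1 \<and> S = {b1..<b2} \<times> {c1..<c2})"

definition rational_rectangle :: "plane set \<Rightarrow> bool" where
  "rational_rectangle R \<longleftrightarrow>
     (\<exists>b1\<in>\<rat>. \<exists>b2\<in>\<rat>. \<exists>c1\<in>\<rat>. \<exists>c2\<in>\<rat>.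
        b1 < b2 \<and> c1 < c2 \<and> R = {b1..<b2} \<times> {c1..<c2})"

text \<open>
  Two linear combinations of disjoint rectangles represent the same tile iff their associated
  functions agree, so a tile is identified with its function on the plane; the ring of weights
  is the type \<^typ>\<open>'a\<close>.  A combination is a finite set of rectangles together
  with a weight for each of them; as rectangles are nonempty, disjoint ones are distinct, so
  no combination is lost by using a set.
\<close>

definition represents ::
    "plane set set \<Rightarrow> (plane set \<Rightarrow> 'a::comm_ring_1) \<Rightarrow> (plane \<Rightarrow> 'a) \<Rightarrow> bool" where
  "represents \<R> a T \<longleftrightarrow>
     finite \<R> \<and> (\<forall>R\<in>\<R>. rectangle R) \<and> disjoint \<R> \<and>
     (\<forall>R\<in>\<R>. \<forall>p\<in>R. T p = a R) \<and> (\<forall>p. p \<notin> \<Union>\<R> \<longrightarrow> T p = 0)"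

definition translate :: "plane \<Rightarrow> (plane \<Rightarrow> 'a) \<Rightarrow> plane \<Rightarrow> 'a" where
  "translate v T = (\<lambda>p. T (p - v))"

definition rescale :: "real \<Rightarrow> (plane \<Rightarrow> 'a) \<Rightarrow> plane \<Rightarrow> 'a" where
  "rescale \<rho> T = (\<lambda>p. T ((1 / \<rho>) *\<^sub>R p))"

definition tiles :: "(plane \<Rightarrow> 'a::comm_ring_1) set \<Rightarrow> (plane \<Rightarrow> 'a) \<Rightarrow> bool" where
  "tiles \<T> U \<longleftrightarrow>
     (\<exists>(n::nat) (a :: nat \<Rightarrow> 'a) (T' :: nat \<Rightarrow> plane \<Rightarrow> 'a).
        (\<forall>i<n. \<exists>T\<in>\<T>. \<exists>v. T' i = translate v T) \<and>
        (\<lambda>p. \<Sum>i<n. a i * T' i p) = U)"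

definition shapetiles :: "(plane \<Rightarrow> 'a::comm_ring_1) \<Rightarrow> (plane \<Rightarrow> 'a) \<Rightarrow> bool" where
  "shapetiles T U \<longleftrightarrow> tiles {rescale \<rho> T | \<rho>. \<rho> > 0} U"

definition weighted_area :: "(plane \<Rightarrow> rat) \<Rightarrow> real" where
  "weighted_area T =
     (THE s. \<exists>\<R> a. represents \<R> a T \<and> s = (\<Sum>R\<in>\<R>. of_rat (a R) * measure lborel R))"

text \<open>
  The weighted area does not depend on the representation, because it is the integral of the
  associated function.
\<close>

lemma rectangle_measure:
  assumes "b1 < b2" "c1 < c2"
  shows "{b1..<b2} \<times> {c1..<c2} \<in> sets (lborel :: plane measure)"
    and "emeasure lborel ({b1..<b2} \<times> {c1..<c2} :: plane set)
           = ennreal ((b2 - b1) * (c2 - c1))"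
    and "measure lborel ({b1..<b2} \<times> {c1..<c2} :: plane set) = (b2 - b1) * (c2 - c1)"
proof -
  show m: "{b1..<b2} \<times> {c1..<c2} \<in> sets (lborel :: plane measure)"
    unfolding lborel_prod[symmetric] by auto
  show e: "emeasure lborel ({b1..<b2} \<times> {c1..<c2} :: plane set)
           = ennreal ((b2 - b1) * (c2 - c1))"
    unfolding lborel_prod[symmetric]
    using assms by (subst lborel.emeasure_pair_measure_Times) (auto simp: ennreal_mult)
  show "measure lborel ({b1..<b2} \<times> {c1..<c2} :: plane set) = (b2 - b1) * (c2 - c1)"
    using assms by (simp add: measure_def e)
qed

lemma represents_integral:
  fixes T :: "plane \<Rightarrow> rat"
  assumes "represents \<R> a T"
  shows "(\<Sum>R\<in>\<R>. of_rat (a R) * measure lborel R) = (\<integral>p. real_of_rat (T p) \<partial>lborel)"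
proof -
  have fin: "finite \<R>" and dis: "disjoint \<R>"
    and val: "\<And>R p. R \<in> \<R> \<Longrightarrow> p \<in> R \<Longrightarrow> T p = a R"
    and out: "\<And>p. p \<notin> \<Union>\<R> \<Longrightarrow> T p = 0"
    using assms unfolding represents_def by auto
  have R: "R \<in> sets lborel \<and> emeasure lborel R < \<infinity>" if "R \<in> \<R>" for R
    using that assms unfolding represents_def rectangle_def
    by (metis ennreal_less_top infinity_ennreal_def rectangle_measure(1,2))
  have T: "real_of_rat (T p) = (\<Sum>R\<in>\<R>. of_rat (a R) * indicator R p)" for p
  proof (cases "p \<in> \<Union>\<R>")
    case False
    then have "(\<Sum>R\<in>\<R>. real_of_rat (a R) * indicator R p) = 0"
      by (intro sum.neutral) (auto simp: indicator_def)
    with out[OF False] show ?thesis by simp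
  next
    case True
    then obtain Q where Q: "Q \<in> \<R>" "p \<in> Q" by blast
    then have "p \<notin> R" if "R \<in> \<R> - {Q}" for R
      using that dis unfolding disjoint_def by blast
    then have "(\<Sum>R\<in>\<R> - {Q}. real_of_rat (a R) * indicator R p) = 0"
      by (intro sum.neutral) (auto simp: indicator_def)
    then have "(\<Sum>R\<in>\<R>. real_of_rat (a R) * indicator R p) = of_rat (a Q)"
      using sum.remove[OF fin Q(1), of "\<lambda>R. real_of_rat (a R) * indicator R p"]
      by (simp only: indicator_simps(1)[OF Q(2)])
    with val[OF Q] show ?thesis by simp
  qed
  have "(\<integral>p. real_of_rat (T p) \<partial>lborel)
      = (\<Sum>R\<in>\<R>. \<integral>p. of_rat (a R) * indicator R p \<partial>lborel)"
    unfolding T by (rule Bochner_Integration.integral_sum) (use R in auto)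
  then show ?thesis by simp
qed

lemma weighted_area_eq:
  assumes "represents \<R> a T"
  shows "weighted_area T = (\<Sum>R\<in>\<R>. of_rat (a R) * measure lborel R)"
  unfolding weighted_area_def
  using assms represents_integral by (intro the_equality) (blast, metis)

end

theory Submission
  imports Defs "HOL-Library.Poly_Mapping"
begin

text \<open>
  If copies of \<open>T\<close> make a square, integrating shows that the area of the square is a multiple of
  the weighted area of \<open>T\<close>.  Conversely, enlarge \<open>T\<close> until its corners are integral, so that it
  becomes \<open>f \<cdot> Q 1\<close>, where \<open>f = (\<Sum>i. c i * u i)\<close> is a combination of translations \<open>u i\<close> in the group
  ring of the plane and \<open>Q N\<close> is the square with corner \<open>0\<close> and side \<open>N\<close>.  Enlarging by a further
  factor \<open>n\<close> gives \<open>f\<^sub>n \<cdot> Q n\<close> with \<open>f\<^sub>n = (\<Sum>i. c i * u i ^ n)\<close>.  As \<open>Q (n * m)\<close> is a multiple of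
  \<open>Q n\<close>, those \<open>p\<close> for which \<open>T\<close> shapetiles some \<open>p \<cdot> Q N\<close> form an ideal, which contains every
  \<open>f\<^sub>n\<close>.  An ideal that contains the power sums \<open>f\<^sub>n\<close> of units contains \<open>1\<close> as soon as
  \<open>\<Sum>i. c i\<close>, here a nonzero multiple of the weighted area, is invertible.
\<close>

section \<open>Ideals and power sums of units\<close>

definition is_ideal :: "'a::comm_ring_1 set \<Rightarrow> bool" where
  "is_ideal J \<longleftrightarrow> 0 \<in> J \<and> (\<forall>x\<in>J. \<forall>y\<in>J. x + y \<in> J) \<and> (\<forall>r. \<forall>x\<in>J. r * x \<in> J)"

lemma is_ideal_diff:
  assumes "is_ideal J" "x \<in> J" "y \<in> J"
  shows "x - y \<in> J"
proof -
  have "x + (- 1) * y \<in> J"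
    using assms unfolding is_ideal_def by blast
  then show ?thesis by simp
qed

text \<open>This is the ideal generated by \<open>J\<close> and \<open>w\<close>. With
  \<open>w = u k - u i\<close> it makes two units equal modulo the ideal, which drives the induction
  below.\<close>

lemma is_ideal_adjoin:
  assumes "is_ideal J"
  shows "is_ideal {x + r * w |x r. x \<in> J}"
proof -
  have 0: "0 \<in> J" and add: "\<And>x y. x \<in> J \<Longrightarrow> y \<in> J \<Longrightarrow> x + y \<in> J"
    and mult: "\<And>r x. x \<in> J \<Longrightarrow> r * x \<in> J"
    using assms unfolding is_ideal_def by auto
  show ?thesis
    unfolding is_ideal_def
  proof (intro conjI ballI allI)
    have "0 = 0 + 0 * w" by simp
    with 0 show "0 \<in> {x + r * w |x r. x \<in> J}" by blast
  next
    fix y z assume "y \<in> {x + r * w |x r. x \<in> J}" "z \<in> {x + r * w |x r. x \<in> J}"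
    then obtain a r b s where "y = a + r * w" "z = b + s * w" "a \<in> J" "b \<in> J" by blast
    then have "y + z = (a + b) + (r + s) * w" "a + b \<in> J"
      using add by (auto simp: algebra_simps)
    then show "y + z \<in> {x + r * w |x r. x \<in> J}" by blast
  next
    fix q y assume "y \<in> {x + r * w |x r. x \<in> J}"
    then obtain a r where "y = a + r * w" "a \<in> J" by blast
    then have "q * y = q * a + (q * r) * w" "q * a \<in> J"
      using mult by (auto simp: algebra_simps)
    then show "q * y \<in> {x + r * w |x r. x \<in> J}" by blast
  qed
qed

text \<open>An element \<open>w\<close> that is invertible modulo \<open>J\<close> can be cancelled
  there, because \<open>y = y * (1 - x * w) + x * (y * w)\<close>.\<close>

lemma is_ideal_cancel:
  assumes J: "is_ideal J" and w: "1 - x * w \<in> J" and y: "y * w \<in> J"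
  shows "y \<in> J"
proof -
  have "y * (1 - x * w) + x * (y * w) \<in> J"
    using assms unfolding is_ideal_def by blast
  then show ?thesis by (simp add: algebra_simps)
qed

text \<open>Vandermonde elimination: subtracting \<open>u j\<close> times the n-th power sum from
  the next one kills the term of \<open>j\<close> and multiplies every other coefficient
  \<open>d i\<close> by \<open>u i - u j\<close>. For \<open>i = k\<close> this factor is invertible
  modulo \<open>J\<close> and can be cancelled again.\<close>

lemma is_ideal_coefficient:
  fixes u :: "'i \<Rightarrow> 'a::comm_ring_1"
  assumes J: "is_ideal J" and "finite B" "k \<notin> B" "u k dvd 1"
    and "\<And>i. i \<in> B \<Longrightarrow> \<exists>x. 1 - x * (u k - u i) \<in> J"
    and "\<And>n. n \<ge> 1 \<Longrightarrow> (\<Sum>i\<in>insert k B. d i * u i ^ n) \<in> J"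
  shows "d k \<in> J"
  using assms(2-)
proof (induction B arbitrary: d rule: finite_induct)
  case empty
  \<comment> \<open>Exponents start at 1, so the last remaining sum is \<open>d k * u k\<close>, and
    the unit \<open>u k\<close> has to be divided out.\<close>
  from empty(2) obtain r where r: "1 = u k * r" by (auto elim: dvdE)
  have "d k * u k \<in> J" using empty(4)[of 1] by simp
  then have "r * (d k * u k) \<in> J" using J unfolding is_ideal_def by blast
  moreover have "r * (d k * u k) = d k * (u k * r)" by (simp only: ac_simps)
  ultimately show ?case using r by simp
next
  case (insert j B)
  let ?d = "\<lambda>i. d i * (u i - u j)"
  have "?d k \<in> J"
  proof (rule insert.IH)
    fix n :: nat assume n: "n \<ge> 1"
    have "(\<Sum>i\<in>insert k (insert j B). d i * u i ^ Suc n) \<in> J"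
      by (rule insert.prems) simp
    moreover have "u j * (\<Sum>i\<in>insert k (insert j B). d i * u i ^ n) \<in> J"
      using insert.prems(4)[OF n] J unfolding is_ideal_def by blast
    ultimately have "(\<Sum>i\<in>insert k (insert j B). d i * u i ^ Suc n)
        - u j * (\<Sum>i\<in>insert k (insert j B). d i * u i ^ n) \<in> J"
      by (rule is_ideal_diff[OF J])
    also have "(\<Sum>i\<in>insert k (insert j B). d i * u i ^ Suc n)
        - u j * (\<Sum>i\<in>insert k (insert j B). d i * u i ^ n)
        = (\<Sum>i\<in>insert k (insert j B). ?d i * u i ^ n)"
      by (simp only: sum_distrib_left sum_subtractf[symmetric])
         (intro sum.cong refl, simp add: algebra_simps)
    also have "\<dots> = (\<Sum>i\<in>insert j (insert k B). ?d i * u i ^ n)"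
      by (simp only: insert_commute)
    also have "\<dots> = (\<Sum>i\<in>insert k B. ?d i * u i ^ n)"
      using insert.hyps insert.prems(1) by (subst sum.insert) auto
    finally show "(\<Sum>i\<in>insert k B. ?d i * u i ^ n) \<in> J" .
  qed (use insert.prems in auto)
  moreover obtain x where "1 - x * (u k - u j) \<in> J" using insert.prems(3) by blast
  ultimately show ?case using is_ideal_cancel[OF J] by blast
qed

text \<open>
  Modulo a difference \<open>u k - u i\<close> the two units merge, so by induction all these differences are
  invertible modulo \<open>J\<close>; a Vandermonde elimination then puts every coefficient into \<open>J\<close>.
\<close>

lemma one_in_ideal_of_power_sums:
  fixes u c :: "'i \<Rightarrow> 'a::comm_ring_1"
  assumes "finite A" "is_ideal J" "\<And>i. i \<in> A \<Longrightarrow> u i dvd 1" "(\<Sum>i\<in>A. c i) dvd 1"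
    and "\<And>n. n \<ge> 1 \<Longrightarrow> (\<Sum>i\<in>A. c i * u i ^ n) \<in> J"
  shows "1 \<in> J"
  using assms
proof (induction "card A" arbitrary: A J c rule: less_induct)
  case less
  note J = less.prems(2)
  have coeff: "c k \<in> J" if k: "k \<in> A" for k
  proof -
    have *: "\<exists>x. 1 - x * (u k - u i) \<in> J" if i: "i \<in> A - {k}" for i
    proof -
      \<comment> \<open>Modulo \<open>u k - u i\<close> the index \<open>i\<close> is dropped and
        its coefficient is moved to \<open>k\<close>. The sum of the coefficients stays the same,
        and the index set shrinks.\<close>
      let ?J = "{x + r * (u k - u i) |x r. x \<in> J}"
      let ?c = "c(k := c k + c i)"
      have merged: "(\<Sum>j\<in>A - {i}. f j) = f k + (\<Sum>j\<in>A - {i} - {k}. f j)"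
        for f :: "'i \<Rightarrow> 'a"
        using i k less.prems(1) by (intro sum.remove) auto
      have split: "(\<Sum>j\<in>A. f j) = f i + (f k + (\<Sum>j\<in>A - {i} - {k}. f j))"
        for f :: "'i \<Rightarrow> 'a"
        using i less.prems(1) unfolding merged[symmetric] by (intro sum.remove) auto
      have "1 \<in> ?J"
      proof (rule less.hyps[of "A - {i}" ?J ?c])
        show "card (A - {i}) < card A"
          using i less.prems(1) by (intro psubset_card_mono) auto
        show "is_ideal ?J" by (rule is_ideal_adjoin[OF J])
        have "(\<Sum>j\<in>A - {i}. ?c j) = (\<Sum>j\<in>A. c j)"
          unfolding split merged by (simp add: ac_simps)
        then show "(\<Sum>j\<in>A - {i}. ?c j) dvd 1" using less.prems(4) by simp
        fix n :: nat assume n: "n \<ge> 1"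
        \<comment> \<open>Merging changes the n-th power sum by
          \<open>c i * (u k ^ n - u i ^ n)\<close>, which the adjoined generator divides.\<close>
        have "u k - u i dvd u k ^ n - u i ^ n"
          unfolding power_diff_sumr2 by (rule dvd_triv_left)
        then obtain q where q: "u k ^ n - u i ^ n = (u k - u i) * q" by (auto elim: dvdE)
        have "(\<Sum>j\<in>A - {i}. ?c j * u j ^ n)
            = (\<Sum>j\<in>A. c j * u j ^ n) + c i * (u k ^ n - u i ^ n)"
          unfolding split merged by (simp add: algebra_simps)
        also have "\<dots> = (\<Sum>j\<in>A. c j * u j ^ n) + (c i * q) * (u k - u i)"
          unfolding q by (simp add: algebra_simps)
        finally show "(\<Sum>j\<in>A - {i}. ?c j * u j ^ n) \<in> ?J"
          using less.prems(5)[OF n] by blast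
      qed (use less.prems in auto)
      then obtain x r where "1 = x + r * (u k - u i)" "x \<in> J" by blast
      then have "1 - r * (u k - u i) \<in> J" by (metis add_diff_cancel_right')
      then show ?thesis by blast
    qed
    show ?thesis
    proof (rule is_ideal_coefficient[where u = u and B = "A - {k}"])
      show "(\<Sum>i\<in>insert k (A - {k}). c i * u i ^ n) \<in> J" if "n \<ge> 1" for n
        using less.prems(5)[OF that] k by (simp add: insert_absorb)
    qed (use less.prems k * in auto)
  qed
  \<comment> \<open>All coefficients lie in \<open>J\<close>, hence so does their sum, which is a
    unit.\<close>
  have "(\<Sum>i\<in>B. c i) \<in> J" if "B \<subseteq> A" for B
    using finite_subset[OF that less.prems(1)] that coeff J
    by (induction B rule: finite_induct) (auto simp: is_ideal_def)
  then have "(\<Sum>i\<in>A. c i) \<in> J" by simp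
  moreover obtain r where "1 = (\<Sum>i\<in>A. c i) * r" using less.prems(4) by (auto elim: dvdE)
  ultimately show ?case using J unfolding is_ideal_def by (metis mult.commute)
qed

section \<open>Group ring and convolution\<close>

text \<open>The group ring of the translations of the plane acts on functions by convolution.\<close>

definition act :: "(plane \<Rightarrow>\<^sub>0 rat) \<Rightarrow> (plane \<Rightarrow> rat) \<Rightarrow> plane \<Rightarrow> rat" where
  "act p F = (\<lambda>z. \<Sum>v\<in>Poly_Mapping.keys p. Poly_Mapping.lookup p v * F (z - v))"

text \<open>Allows the supports of \<open>p\<close>, \<open>q\<close> and \<open>p + q\<close> to be
  replaced by one common index set.\<close>

lemma act_superset:
  assumes "finite A" "Poly_Mapping.keys p \<subseteq> A"
  shows "act p F z = (\<Sum>v\<in>A. Poly_Mapping.lookup p v * F (z - v))"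
  unfolding act_def using assms
  by (intro sum.mono_neutral_left) (auto simp: in_keys_iff)

lemma act_zero [simp]: "act 0 F = (\<lambda>_. 0)"
  by (simp add: act_def)

lemma act_add: "act (p + q) F = (\<lambda>z. act p F z + act q F z)"
proof
  fix z
  let ?A = "Poly_Mapping.keys p \<union> Poly_Mapping.keys q"
  have "Poly_Mapping.keys (p + q) \<subseteq> ?A" by (rule keys_add)
  then show "act (p + q) F z = act p F z + act q F z"
    by (subst (1 2 3) act_superset[of ?A])
       (auto simp: lookup_add sum.distrib algebra_simps)
qed

lemma act_sum: "act (\<Sum>i\<in>A. p i) F = (\<lambda>z. \<Sum>i\<in>A. act (p i) F z)"
  by (induction A rule: infinite_finite_induct) (auto simp: act_add)

lemma act_single: "act (Poly_Mapping.single v c) F = (\<lambda>z. c * F (z - v))"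
  by (cases "c = 0") (auto simp: act_def)

lemma poly_mapping_sum_single:
  "p = (\<Sum>v\<in>Poly_Mapping.keys p. Poly_Mapping.single v (Poly_Mapping.lookup p v))"
proof (rule poly_mapping_eqI)
  fix k
  show "Poly_Mapping.lookup p k = Poly_Mapping.lookup
      (\<Sum>v\<in>Poly_Mapping.keys p. Poly_Mapping.single v (Poly_Mapping.lookup p v)) k"
    by (auto simp: lookup_sum lookup_single when_def in_keys_iff)
qed

text \<open>By linearity only a single translation on the left matters, and translations compose by
  adding their vectors. As the ring is commutative, operators may then be interchanged.\<close>

lemma act_mult: "act (p * q) F = act p (act q F)"
proof
  fix z
  have single: "act (Poly_Mapping.single v c * q) F z = c * act q F (z - v)" for v c z
  proof -
    have "act (Poly_Mapping.single v c * q) F z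
        = act (\<Sum>w\<in>Poly_Mapping.keys q.
            Poly_Mapping.single (v + w) (c * Poly_Mapping.lookup q w)) F z"
      by (subst poly_mapping_sum_single[of q]) (simp add: sum_distrib_left mult_single)
    then show ?thesis
      by (simp add: act_sum act_single act_def[of q] sum_distrib_left mult.assoc diff_diff_eq)
  qed
  have "act (p * q) F z = act (\<Sum>v\<in>Poly_Mapping.keys p.
      Poly_Mapping.single v (Poly_Mapping.lookup p v) * q) F z"
    by (subst poly_mapping_sum_single[of p]) (simp add: sum_distrib_right)
  then show "act (p * q) F z = act p (act q F) z"
    by (simp add: act_sum single act_def[of p])
qed

text \<open>Together with \<open>rescale_act\<close> this is the source of the power sums: enlarging
  by \<open>n\<close> multiplies each translation vector by \<open>n\<close>, which raises the
  corresponding unit to the n-th power.\<close>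

lemma single_power:
  "Poly_Mapping.single v (1::'a::comm_semiring_1) ^ n
    = Poly_Mapping.single (of_nat n *\<^sub>R v :: 'b::real_vector) 1"
proof (induction n)
  case (Suc n)
  then show ?case by (simp add: mult_single algebra_simps)
qed simp

lemma rescale_rescale: "rescale a (rescale b F) = rescale (a * b) F"
  by (auto simp: rescale_def mult.commute fun_eq_iff)

text \<open>Conjugating the translation by \<open>v\<close> with the rescaling gives the translation
  by \<open>\<rho> *\<^sub>R v\<close>.\<close>

lemma rescale_act:
  assumes "\<rho> \<noteq> 0"
  shows "rescale \<rho> (act (\<Sum>i\<in>A. Poly_Mapping.single (v i) (c i)) F)
    = act (\<Sum>i\<in>A. Poly_Mapping.single (\<rho> *\<^sub>R v i) (c i)) (rescale \<rho> F)"
  using assms by (auto simp: rescale_def act_sum act_single fun_eq_iff scaleR_diff_right)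

section \<open>Squares and functions constant on lattice cells\<close>

definition corner_square :: "real \<Rightarrow> plane \<Rightarrow> rat" where
  "corner_square s = indicator ({0..<s} \<times> {0..<s})"

lemma rescale_corner_square:
  assumes "\<rho> > 0"
  shows "rescale \<rho> (corner_square s) = corner_square (\<rho> * s)"
  using assms by (auto simp: rescale_def corner_square_def indicator_def fun_eq_iff field_simps)

text \<open>The first hypothesis says that \<open>F\<close> is constant on each half-open unit cell.
  These cells partition the plane, so \<open>F\<close> is the sum of their indicators weighted by
  its values at their lower left corners.\<close>

lemma lattice_decomposition:
  fixes F :: "plane \<Rightarrow> rat"
  assumes F: "\<And>x y. F (x, y) = F (of_int \<lfloor>x\<rfloor>, of_int \<lfloor>y\<rfloor>)"
    and A: "finite A" "\<And>i j. F (of_int i, of_int j) \<noteq> 0 \<Longrightarrow> (i, j) \<in> A"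
  shows "F = act (\<Sum>(i, j)\<in>A.
    Poly_Mapping.single (of_int i, of_int j) (F (of_int i, of_int j))) (corner_square 1)"
proof
  fix z :: plane
  obtain x y where z: "z = (x, y)" by (cases z)
  have sq: "corner_square 1 (x - of_int i, y - of_int j) = (if (i, j) = (\<lfloor>x\<rfloor>, \<lfloor>y\<rfloor>) then 1 else 0)"
    for i j
    by (auto simp: corner_square_def indicator_def) linarith+
  have "act (\<Sum>(i, j)\<in>A.
      Poly_Mapping.single (of_int i, of_int j) (F (of_int i, of_int j))) (corner_square 1) z
      = (\<Sum>a\<in>A. if a = (\<lfloor>x\<rfloor>, \<lfloor>y\<rfloor>) then F (of_int \<lfloor>x\<rfloor>, of_int \<lfloor>y\<rfloor>) else 0)"
    unfolding z act_sum
    by (intro sum.cong refl) (auto simp: act_single sq split: prod.splits)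
  also have "\<dots> = F (of_int \<lfloor>x\<rfloor>, of_int \<lfloor>y\<rfloor>)"
    using A by (auto simp: sum.delta')
  also have "\<dots> = F z" unfolding z by (rule F[symmetric])
  finally show "F z = act (\<Sum>(i, j)\<in>A.
      Poly_Mapping.single (of_int i, of_int j) (F (of_int i, of_int j))) (corner_square 1) z" ..
qed

text \<open>A square of side \<open>m\<close> is cut into unit cells, and the picture is then
  rescaled by \<open>s\<close>.\<close>

lemma corner_square_multiple:
  assumes "s > 0" "m > 0"
  shows "\<exists>p. corner_square (s * of_nat m) = act p (corner_square s)"
proof -
  let ?A = "{0..<int m} \<times> {0..<int m}"
  have "corner_square (of_nat m) = act (\<Sum>(i, j)\<in>?A.
      Poly_Mapping.single (of_int i, of_int j) (corner_square (of_nat m) (of_int i, of_int j)))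
      (corner_square 1)"
  proof (rule lattice_decomposition)
    fix x y :: real
    have "x < of_nat m \<longleftrightarrow> of_int \<lfloor>x\<rfloor> < real m" for x :: real
      using floor_less_iff[of x "int m"] by (metis of_int_less_iff of_int_of_nat_eq)
    then show "corner_square (of_nat m) (x, y) = corner_square (of_nat m) (of_int \<lfloor>x\<rfloor>, of_int \<lfloor>y\<rfloor>)"
      by (auto simp: corner_square_def indicator_def)
  qed (auto simp: corner_square_def indicator_def split: if_splits)
  then have "rescale s (corner_square (of_nat m)) = rescale s (act (\<Sum>a\<in>?A.
      Poly_Mapping.single (of_int (fst a), of_int (snd a))
        (corner_square (of_nat m) (of_int (fst a), of_int (snd a))))
      (corner_square 1))"
    by (simp add: case_prod_unfold)
  then show ?thesis
    using assms by (auto simp: rescale_act rescale_corner_square)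
qed

section \<open>Closure properties of tiling\<close>

lemma tiles_zero: "tiles \<T> (\<lambda>_. 0)"
  unfolding tiles_def by (intro exI[of _ 0]) auto

lemma tiles_add:
  fixes F G :: "plane \<Rightarrow> 'a::comm_ring_1"
  assumes "tiles \<T> F" "tiles \<T> G"
  shows "tiles \<T> (\<lambda>z. F z + G z)"
proof -
  obtain n a and f :: "nat \<Rightarrow> plane \<Rightarrow> 'a" where f: "\<forall>i<n. \<exists>T\<in>\<T>. \<exists>v. f i = translate v T" "(\<lambda>p. \<Sum>i<n. a i * f i p) = F"
    using assms(1) unfolding tiles_def by blast
  obtain m b and g :: "nat \<Rightarrow> plane \<Rightarrow> 'a" where g: "\<forall>i<m. \<exists>T\<in>\<T>. \<exists>v. g i = translate v T" "(\<lambda>p. \<Sum>i<m. b i * g i p) = G"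
    using assms(2) unfolding tiles_def by blast
  let ?c = "\<lambda>i. if i < n then a i else b (i - n)"
  let ?h = "\<lambda>i. if i < n then f i else g (i - n)"
  have "(\<Sum>i<n + m. h i) = (\<Sum>i<n. h i) + (\<Sum>i<m. h (n + i))" for h :: "nat \<Rightarrow> 'a"
    by (induction m) (auto simp: add.assoc)
  then have "(\<Sum>i<n + m. ?c i * ?h i p) = F p + G p" for p
    by (simp add: f(2)[symmetric] g(2)[symmetric])
  moreover have "\<forall>i<n + m. \<exists>T\<in>\<T>. \<exists>v. ?h i = translate v T"
    using f(1) g(1) by auto
  ultimately show ?thesis
    unfolding tiles_def by (intro exI[of _ "n + m"] exI[of _ ?c] exI[of _ ?h]) blast
qed

lemma tiles_scale_translate:
  fixes F :: "plane \<Rightarrow> 'a::comm_ring_1"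
  assumes "tiles \<T> F"
  shows "tiles \<T> (\<lambda>z. c * F (z - v))"
proof -
  obtain n a and f :: "nat \<Rightarrow> plane \<Rightarrow> 'a" where f: "\<forall>i<n. \<exists>T\<in>\<T>. \<exists>v. f i = translate v T" "(\<lambda>p. \<Sum>i<n. a i * f i p) = F"
    using assms(1) unfolding tiles_def by blast
  have "(\<Sum>i<n. (c * a i) * translate v (f i) p) = c * F (p - v)" for p
    by (simp add: f(2)[symmetric] sum_distrib_left translate_def mult.assoc)
  moreover have "\<forall>i<n. \<exists>T\<in>\<T>. \<exists>w. translate v (f i) = translate w T"
  proof (intro allI impI)
    fix i assume "i < n"
    then obtain T w where "T \<in> \<T>" "f i = translate w T" using f(1) by blast
    then have "translate v (f i) = translate (v + w) T"
      by (simp add: translate_def diff_diff_eq)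
    with \<open>T \<in> \<T>\<close> show "\<exists>T\<in>\<T>. \<exists>w. translate v (f i) = translate w T" by blast
  qed
  ultimately show ?thesis
    unfolding tiles_def
    by (intro exI[of _ n] exI[of _ "\<lambda>i. c * a i"] exI[of _ "\<lambda>i. translate v (f i)"]) blast
qed

text \<open>The tiled functions form a module over the group ring; this is what makes the set
  \<open>J\<close> below an ideal.\<close>

lemma tiles_act:
  assumes "tiles \<T> F"
  shows "tiles \<T> (act p F)"
proof -
  have "tiles \<T> (\<lambda>z. \<Sum>v\<in>B. Poly_Mapping.lookup p v * F (z - v))" for B
    by (induction B rule: infinite_finite_induct)
       (auto simp: tiles_zero intro!: tiles_add tiles_scale_translate assms)
  then show ?thesis by (simp add: act_def)
qed

lemma tiles_member:
  assumes "T \<in> \<T>"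
  shows "tiles \<T> T"
  unfolding tiles_def using assms
  by (intro exI[of _ "Suc 0"] exI[of _ "\<lambda>_. 1"] exI[of _ "\<lambda>_. T"])
     (auto simp: translate_def intro!: bexI[of _ T] exI[of _ 0])

section \<open>Integrals of tiles\<close>

text \<open>Adds integrability to the value of the integral, so that integrals of rescaled copies
  can be computed and added.\<close>

lemma represents_has_integral:
  fixes T :: "plane \<Rightarrow> rat"
  assumes rep: "represents \<R> a T"
  shows "has_bochner_integral lborel (\<lambda>p. real_of_rat (T p)) (weighted_area T)"
proof -
  have R: "R \<in> sets lborel \<and> emeasure lborel R < \<infinity>" if "R \<in> \<R>" for R
    using that rep unfolding represents_def rectangle_def
    by (metis ennreal_less_top infinity_ennreal_def rectangle_measure(1,2))
  have T: "real_of_rat (T p) = (\<Sum>R\<in>\<R>. of_rat (a R) * indicator R p)" for p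
  proof (cases "\<exists>Q\<in>\<R>. p \<in> Q")
    case True
    then obtain Q where Q: "Q \<in> \<R>" "p \<in> Q" by blast
    have "p \<in> R \<longleftrightarrow> R = Q" if "R \<in> \<R>" for R
      using that Q rep unfolding represents_def disjoint_def by blast
    then have "real_of_rat (a R) * indicator R p = (if R = Q then real_of_rat (a Q) else 0)"
      if "R \<in> \<R>" for R
      using that by (cases "R = Q") (simp_all only: indicator_def if_True if_False, simp_all)
    then have "(\<Sum>R\<in>\<R>. real_of_rat (a R) * indicator R p)
        = (\<Sum>R\<in>\<R>. if R = Q then real_of_rat (a Q) else 0)"
      by (rule sum.cong[OF refl])
    moreover have "finite \<R>" "T p = a Q" using Q rep unfolding represents_def by blast+
    ultimately show ?thesis using Q(1) by simp
  next
    case False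
    then have "(\<Sum>R\<in>\<R>. real_of_rat (a R) * indicator R p) = 0"
      by (intro sum.neutral) (auto simp: indicator_def)
    moreover have "T p = 0" using False rep unfolding represents_def by blast
    ultimately show ?thesis by simp
  qed
  have "integrable lborel (\<lambda>p. real_of_rat (T p))"
    unfolding T using R by (intro Bochner_Integration.integrable_sum) auto
  then show ?thesis
    using represents_integral[OF rep] weighted_area_eq[OF rep]
    by (simp add: has_bochner_integral_iff)
qed

lemma has_integral_affine:
  fixes f :: "'a::euclidean_space \<Rightarrow> real"
  assumes f: "has_bochner_integral lborel f x" and c: "c \<noteq> 0"
  shows "has_bochner_integral lborel (\<lambda>p. f (t + c *\<^sub>R p)) (x / \<bar>c\<bar> ^ DIM('a))"
proof -
  \<comment> \<open>By \<open>lborel_affine\<close> this measure is \<open>lborel\<close> itself;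
    unfolding the density and the image measure is the change of variables.\<close>
  let ?D = "density (distr lborel borel (\<lambda>x. t + c *\<^sub>R x)) (\<lambda>_. \<bar>c\<bar>^DIM('a))"
  have [measurable]: "f \<in> borel_measurable borel"
    using borel_measurable_has_bochner_integral[OF f] by simp
  have "has_bochner_integral ?D f x"
    using f lborel_affine[OF c, of t] by simp
  then have "integrable ?D f" "integral\<^sup>L ?D f = x"
    by (auto simp: has_bochner_integral_iff)
  then show ?thesis
    using c by (simp add: has_bochner_integral_iff integrable_density integral_density
        integrable_distr_eq integral_distr field_simps)
qed

lemma has_integral_translate_rescale:
  assumes "has_bochner_integral lborel (\<lambda>p. real_of_rat (T p)) x" "\<rho> > 0"
  shows "has_bochner_integral lborel (\<lambda>p. real_of_rat (translate v (rescale \<rho> T) p)) (\<rho>\<^sup>2 * x)"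
proof -
  have "(\<lambda>p. real_of_rat (translate v (rescale \<rho> T) p))
      = (\<lambda>p. real_of_rat (T (- ((1 / \<rho>) *\<^sub>R v) + (1 / \<rho>) *\<^sub>R p)))"
    by (auto simp: translate_def rescale_def scaleR_diff_right)
  then show ?thesis
    using has_integral_affine[OF assms(1), of "1 / \<rho>" "- ((1 / \<rho>) *\<^sub>R v)"] assms(2)
    by (simp add: power2_eq_square field_simps)
qed

lemma corner_square_integral:
  assumes "s > 0"
  shows "has_bochner_integral lborel (\<lambda>p. real_of_rat (corner_square s p)) (s\<^sup>2)"
proof -
  have "has_bochner_integral lborel (indicator ({0..<s} \<times> {0..<s}) :: plane \<Rightarrow> real)
      (measure lborel ({0..<s} \<times> {0..<s} :: plane set))"
    using rectangle_measure[of 0 s 0 s] assms by (intro has_bochner_integral_real_indicator) auto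
  moreover have "(indicator ({0..<s} \<times> {0..<s}) :: plane \<Rightarrow> real)
      = (\<lambda>p. real_of_rat (corner_square s p))"
    by (auto simp: corner_square_def indicator_def)
  ultimately show ?thesis
    using rectangle_measure(3)[of 0 s 0 s] assms by (simp add: power2_eq_square)
qed


section \<open>Rational corners and a common grid\<close>

definition grid_rectangle :: "nat \<Rightarrow> plane set \<Rightarrow> bool" where
  "grid_rectangle D R \<longleftrightarrow> (\<exists>b1 b2 c1 c2. real D * b1 \<in> \<int> \<and> real D * b2 \<in> \<int> \<and>
     real D * c1 \<in> \<int> \<and> real D * c2 \<in> \<int> \<and> R = {b1..<b2} \<times> {c1..<c2})"

text \<open>The grid of mesh \<open>1 / (k * D)\<close> refines that of mesh \<open>1 / D\<close>,
  so finitely many rational rectangles share a grid.\<close>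

lemma grid_rectangle_multiple:
  assumes "grid_rectangle D R"
  shows "grid_rectangle (k * D) R"
proof -
  obtain b1 b2 c1 c2 where *: "real D * b1 \<in> \<int>" "real D * b2 \<in> \<int>"
     "real D * c1 \<in> \<int>" "real D * c2 \<in> \<int>" "R = {b1..<b2} \<times> {c1..<c2}"
    using assms unfolding grid_rectangle_def by blast
  have "real (k * D) * x \<in> \<int>" if "real D * x \<in> \<int>" for x
    using Ints_mult[OF Ints_of_nat that, of k] by (simp add: mult.assoc)
  with * show ?thesis unfolding grid_rectangle_def by blast
qed

lemma Rats_common_denominator:
  assumes "finite X" "X \<subseteq> (\<rat> :: real set)"
  shows "\<exists>D::nat. D > 0 \<and> (\<forall>x\<in>X. real D * x \<in> \<int>)"
  using assms
proof (induction X rule: finite_induct)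
  case empty
  show ?case by (intro exI[of _ 1]) auto
next
  case (insert x X)
  then obtain D :: nat where D: "D > 0" "\<forall>x\<in>X. real D * x \<in> \<int>" by auto
  obtain i :: int and n :: nat where n: "n \<noteq> 0" "x = of_int i / of_nat n"
    using insert.prems unfolding Rats_eq_int_div_nat by auto
  have "real (n * D) * x = of_int (int D * i)" using n by simp
  then have "real (n * D) * x \<in> \<int>" by (metis Ints_of_int)
  moreover have "real (n * D) * y \<in> \<int>" if "y \<in> X" for y
    using Ints_mult[OF Ints_of_nat, of "real D * y" n] D(2) that by (simp add: mult.assoc)
  ultimately show ?case using D n by (intro exI[of _ "n * D"]) auto
qed

lemma rational_rectangles_on_grid:
  assumes "finite \<R>" "\<And>R. R \<in> \<R> \<Longrightarrow> rational_rectangle R"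
  shows "\<exists>D>0. \<forall>R\<in>\<R>. grid_rectangle D R"
  using assms
proof (induction \<R> rule: finite_induct)
  case empty
  show ?case by auto
next
  case (insert R \<R>)
  then obtain D where D: "D > 0" "\<forall>R\<in>\<R>. grid_rectangle D R" by auto
  obtain b1 b2 c1 c2 where R: "{b1, b2, c1, c2} \<subseteq> \<rat>" "R = {b1..<b2} \<times> {c1..<c2}"
    using insert.prems(1)[of R] unfolding rational_rectangle_def by auto
  obtain E :: nat where E: "E > 0" "\<forall>x\<in>{b1, b2, c1, c2}. real E * x \<in> \<int>"
    using Rats_common_denominator[OF _ R(1)] by auto
  have "grid_rectangle E R" unfolding grid_rectangle_def using E(2) R(2) by auto
  then have "grid_rectangle (D * E) R" by (rule grid_rectangle_multiple)
  moreover have "grid_rectangle (D * E) Q" if "Q \<in> \<R>" for Q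
    using grid_rectangle_multiple[of D Q E] D(2) that by (simp add: mult.commute)
  ultimately show ?case using D E by (intro exI[of _ "D * E"]) auto
qed

text \<open>Enlarged by \<open>D\<close>, the rectangle has integral sides, and comparing a real
  with an integer bound in this half-open form depends only on its floor. Boundedness gives the
  finiteness.\<close>

lemma grid_rectangle_floor:
  assumes "grid_rectangle D R" "D > 0"
  shows "(x / D, y / D) \<in> R \<longleftrightarrow> (of_int \<lfloor>x\<rfloor> / D, of_int \<lfloor>y\<rfloor> / D) \<in> R"
    and "finite {(i, j). (of_int i / D, of_int j / D) \<in> R}"
proof -
  obtain b1 b2 c1 c2 where R: "real D * b1 \<in> \<int>" "real D * b2 \<in> \<int>"
     "real D * c1 \<in> \<int>" "real D * c2 \<in> \<int>" "R = {b1..<b2} \<times> {c1..<c2}"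
    using assms unfolding grid_rectangle_def by blast
  obtain i1 i2 j1 j2 where ij: "real D * b1 = of_int i1" "real D * b2 = of_int i2"
     "real D * c1 = of_int j1" "real D * c2 = of_int j2"
    using R(1-4) by (auto elim!: Ints_cases)
  have mem: "(u / D, v / D) \<in> R \<longleftrightarrow> (of_int i1 \<le> u \<and> u < of_int i2) \<and> (of_int j1 \<le> v \<and> v < of_int j2)"
    for u v
    unfolding ij[symmetric] R(5) using assms(2) by (auto simp: field_simps)
  show "(x / D, y / D) \<in> R \<longleftrightarrow> (of_int \<lfloor>x\<rfloor> / D, of_int \<lfloor>y\<rfloor> / D) \<in> R"
    unfolding mem by (simp add: le_floor_iff floor_less_iff)
  have "{(i, j). (of_int i / D, of_int j / D) \<in> R} \<subseteq> {i1..<i2} \<times> {j1..<j2}"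
    unfolding mem by auto
  then show "finite {(i, j). (of_int i / D, of_int j / D) \<in> R}"
    by (rule finite_subset) simp
qed

lemma rational_tile_decomposition:
  fixes T :: "plane \<Rightarrow> rat"
  assumes rep: "represents \<R> a T" and rat: "\<forall>R\<in>\<R>. rational_rectangle R"
  obtains D :: nat and A :: "(int \<times> int) set" and v c where "D > 0" "finite A"
    "rescale (of_nat D) T = act (\<Sum>i\<in>A. Poly_Mapping.single (v i) (c i)) (corner_square 1)"
proof -
  have fin: "finite \<R>" and val: "\<And>R p. R \<in> \<R> \<Longrightarrow> p \<in> R \<Longrightarrow> T p = a R"
    and out: "\<And>p. p \<notin> \<Union>\<R> \<Longrightarrow> T p = 0"
    using rep unfolding represents_def by auto
  obtain D where D: "D > 0" "\<forall>R\<in>\<R>. grid_rectangle D R"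
    using rational_rectangles_on_grid[OF fin] rat by blast
  define F where "F = rescale (of_nat D) T"
  have F: "F (x, y) = T (x / D, y / D)" for x y
    by (simp add: F_def rescale_def)
  \<comment> \<open>The lower left corners of the unit cells covered by the enlarged
    rectangles.\<close>
  define A where "A = (\<Union>R\<in>\<R>. {(i, j). (of_int i / real D, of_int j / real D) \<in> R})"
  have finA: "finite A"
    unfolding A_def using fin D grid_rectangle_floor(2) by blast
  have "F = act (\<Sum>(i, j)\<in>A.
    Poly_Mapping.single (of_int i, of_int j) (F (of_int i, of_int j))) (corner_square 1)"
  proof (rule lattice_decomposition[OF _ finA])
    fix x y
    have *: "(x / D, y / D) \<in> R \<longleftrightarrow> (of_int \<lfloor>x\<rfloor> / D, of_int \<lfloor>y\<rfloor> / D) \<in> R" if "R \<in> \<R>" for R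
      using grid_rectangle_floor(1) D that by blast
    show "F (x, y) = F (of_int \<lfloor>x\<rfloor>, of_int \<lfloor>y\<rfloor>)"
    proof (cases "(x / D, y / D) \<in> \<Union>\<R>")
      case True
      then obtain R where "R \<in> \<R>" "(x / D, y / D) \<in> R" by blast
      then show ?thesis unfolding F using val * by metis
    next
      case False
      then have "(of_int \<lfloor>x\<rfloor> / D, of_int \<lfloor>y\<rfloor> / D) \<notin> \<Union>\<R>" using * by blast
      then show ?thesis unfolding F using out False by metis
    qed
  next
    fix i j assume "F (of_int i, of_int j) \<noteq> 0"
    then show "(i, j) \<in> A" unfolding F A_def using out by auto
  qed
  then have "rescale (of_nat D) T = act (\<Sum>a\<in>A. Poly_Mapping.single
      (of_int (fst a), of_int (snd a)) (F (of_int (fst a), of_int (snd a)))) (corner_square 1)"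
    unfolding F_def[symmetric] by (simp add: case_prod_unfold)
  with D(1) finA show ?thesis by (rule that)
qed

text \<open>Every translated unit square has integral 1. This identifies the sum of the coefficients
  with the area of the enlarged tile.\<close>

lemma act_corner_square_integral:
  "has_bochner_integral lborel
    (\<lambda>p. real_of_rat (act (\<Sum>i\<in>A. Poly_Mapping.single (v i) (c i)) (corner_square 1) p))
    (real_of_rat (\<Sum>i\<in>A. c i))"
proof -
  have "has_bochner_integral lborel (\<lambda>p. real_of_rat (c i) * real_of_rat (corner_square 1 (p - v i)))
      (real_of_rat (c i) * 1)" for i
    using has_integral_affine[OF corner_square_integral[of 1], of 1 "- v i"]
    by (intro has_bochner_integral_mult_right) simp
  then have "has_bochner_integral lborel
      (\<lambda>p. \<Sum>i\<in>A. real_of_rat (c i) * real_of_rat (corner_square 1 (p - v i)))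
      (\<Sum>i\<in>A. real_of_rat (c i) * 1)"
    by (rule has_bochner_integral_sum)
  then show ?thesis
    by (simp add: act_sum act_single of_rat_sum of_rat_mult)
qed

section \<open>Tiling a square\<close>

lemma shapetiles_corner_square:
  fixes T :: "plane \<Rightarrow> rat" and A :: "'i set"
  assumes D: "D > 0" and A: "finite A"
    and T: "rescale D T = act (\<Sum>i\<in>A. Poly_Mapping.single (v i) (c i)) (corner_square 1)"
    and c: "(\<Sum>i\<in>A. c i) \<noteq> 0"
  shows "\<exists>N::nat. N > 0 \<and> shapetiles T (corner_square (of_nat N))"
proof -
  let ?\<T> = "{rescale \<rho> T |\<rho>. \<rho> > 0}"
  let ?Q = "\<lambda>N::nat. corner_square (of_nat N)"
  \<comment> \<open>The side \<open>N\<close> may depend on \<open>p\<close>;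
    \<open>multiple\<close> lets two elements be compared on a square whose side is the product of
    theirs.\<close>
  define J where "J = {p. \<exists>N>0. tiles ?\<T> (act p (?Q N))}"
  have multiple: "tiles ?\<T> (act p (?Q (N * M)))"
    if tiles: "tiles ?\<T> (act p (?Q N))" and pos: "N > 0" "M > 0" for p N M
  proof -
    obtain q where "?Q (N * M) = act q (?Q N)"
      using corner_square_multiple[of "real N" M] pos by auto
    then have "act p (?Q (N * M)) = act q (act p (?Q N))"
      by (simp add: act_mult[symmetric] mult.commute)
    with tiles_act[OF tiles] show ?thesis by simp
  qed
  have J: "is_ideal J"
    unfolding is_ideal_def
  proof (intro conjI ballI allI)
    show "0 \<in> J" by (auto simp: J_def tiles_zero)
  next
    fix p q assume "p \<in> J" "q \<in> J"
    then obtain N M where *: "N > 0" "tiles ?\<T> (act p (?Q N))" "M > 0" "tiles ?\<T> (act q (?Q M))"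
      unfolding J_def by auto
    have "tiles ?\<T> (act p (?Q (N * M)))" "tiles ?\<T> (act q (?Q (N * M)))"
      using multiple[OF *(2,1,3)] multiple[OF *(4,3,1)] by (simp_all add: mult.commute)
    then have "tiles ?\<T> (act (p + q) (?Q (N * M)))"
      unfolding act_add by (rule tiles_add)
    with * show "p + q \<in> J" unfolding J_def by (auto intro!: exI[of _ "N * M"])
  next
    fix r p assume "p \<in> J"
    then show "r * p \<in> J" unfolding J_def by (auto simp: act_mult intro: tiles_act)
  qed
  have "1 \<in> J"
  proof (rule one_in_ideal_of_power_sums[OF A J])
    show "Poly_Mapping.single (v i) 1 dvd (1 :: plane \<Rightarrow>\<^sub>0 rat)" for i
      by (rule dvdI[of _ _ "Poly_Mapping.single (- v i) 1"]) (simp add: mult_single)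
    \<comment> \<open>A nonzero rational is invertible as a constant of the group ring.\<close>
    have "Poly_Mapping.single 0 (\<Sum>i\<in>A. c i) dvd (1 :: plane \<Rightarrow>\<^sub>0 rat)"
      using c by (intro dvdI[of _ _ "Poly_Mapping.single 0 (1 / (\<Sum>i\<in>A. c i))"])
        (simp add: mult_single)
    also have "Poly_Mapping.single 0 (\<Sum>i\<in>A. c i) = (\<Sum>i\<in>A. Poly_Mapping.single (0::plane) (c i))"
      using A by (induction A rule: finite_induct) (auto simp: single_add)
    finally show "(\<Sum>i\<in>A. Poly_Mapping.single (0::plane) (c i)) dvd 1" .
    fix n :: nat assume n: "n \<ge> 1"
    have "(\<Sum>i\<in>A. Poly_Mapping.single 0 (c i) * Poly_Mapping.single (v i) 1 ^ n)
        = (\<Sum>i\<in>A. Poly_Mapping.single (of_nat n *\<^sub>R v i) (c i))"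
      by (simp add: single_power mult_single)
    \<comment> \<open>Rescaling the decomposition of \<open>rescale D T\<close> by \<open>n\<close>
      yields the n-th power sum acting on the square of side \<open>n\<close>, so
      \<open>N = n\<close> witnesses membership in \<open>J\<close>.\<close>
    moreover have "act (\<Sum>i\<in>A. Poly_Mapping.single (of_nat n *\<^sub>R v i) (c i)) (?Q n)
        = rescale (of_nat n * D) T"
      using n unfolding rescale_rescale[symmetric] T
      by (simp add: rescale_act rescale_corner_square)
    moreover have "tiles ?\<T> (rescale (of_nat n * D) T)"
      using n D by (intro tiles_member) auto
    ultimately show "(\<Sum>i\<in>A. Poly_Mapping.single 0 (c i) * Poly_Mapping.single (v i) 1 ^ n) \<in> J"
      using n unfolding J_def by (auto intro!: exI[of _ n])
  qed
  \<comment> \<open>The unit of the group ring is the translation by 0, so \<open>1 \<in> J\<close>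
    says that a square itself is tiled.\<close>
  moreover have "act 1 F = F" for F
    using act_single[of 0 1 F] by simp
  ultimately show ?thesis unfolding J_def shapetiles_def by auto
qed

theorem theorem3p1:
  fixes T :: "plane \<Rightarrow> rat"
  assumes "\<exists>\<R> a. represents \<R> a T \<and> (\<forall>R\<in>\<R>. rational_rectangle R)"
  shows "(\<exists>S. square S \<and> shapetiles T (indicator S)) \<longleftrightarrow> weighted_area T \<noteq> 0"
proof -
  obtain \<R> a where rep: "represents \<R> a T" and rat: "\<forall>R\<in>\<R>. rational_rectangle R"
    using assms by blast
  note area = represents_has_integral[OF rep]
  show ?thesis
  proof
    assume "\<exists>S. square S \<and> shapetiles T (indicator S)"
    then obtain S where S: "square S" "shapetiles T (indicator S)" by blast
    from S(2) obtain n b and T' :: "nat \<Rightarrow> plane \<Rightarrow> rat" where T': "\<forall>i<n. \<exists>U\<in>{rescale \<rho> T |\<rho>. \<rho> > 0}. \<exists>v. T' i = translate v U"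
        "(\<lambda>p. \<Sum>i<n. b i * T' i p) = indicator S"
      unfolding shapetiles_def tiles_def by blast
    show "weighted_area T \<noteq> 0"
    proof
      assume 0: "weighted_area T = 0"
      \<comment> \<open>Every rescaled and translated copy of \<open>T\<close> would have integral
        0, and so would the square, whose area is positive.\<close>
      have "has_bochner_integral lborel (\<lambda>p. real_of_rat (b i) * real_of_rat (T' i p)) 0" if i: "i < n" for i
      proof -
        obtain \<rho> v where "\<rho> > 0" "T' i = translate v (rescale \<rho> T)"
          using T'(1) i by blast
        then have "has_bochner_integral lborel (\<lambda>p. real_of_rat (T' i p)) 0"
          using has_integral_translate_rescale[OF area, of \<rho> v] 0 by simp
        then show ?thesis
          using has_bochner_integral_mult_right[of "real_of_rat (b i)"] by fastforce
      qed
      then have "has_bochner_integral lborel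
          (\<lambda>p. \<Sum>i<n. real_of_rat (b i) * real_of_rat (T' i p)) (\<Sum>i<n. 0)"
        by (intro has_bochner_integral_sum) auto
      moreover have "(\<Sum>i<n. real_of_rat (b i) * real_of_rat (T' i p)) = indicator S p" for p
        using arg_cong[OF fun_cong[OF T'(2), of p], of real_of_rat]
        by (auto simp: of_rat_sum of_rat_mult indicator_def split: if_splits)
      ultimately have "(\<integral>p. indicator S p \<partial>lborel) = (0::real)"
        by (simp add: has_bochner_integral_iff)
      moreover obtain b1 b2 c1 c2 where "b1 < b2" "c1 < c2" "S = {b1..<b2} \<times> {c1..<c2}"
        using S(1) unfolding square_def by blast
      ultimately show False
        using rectangle_measure(3)[of b1 b2 c1 c2] by simp
    qed
  next
    assume nz: "weighted_area T \<noteq> 0"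
    obtain D :: nat and A :: "(int \<times> int) set" and v c where D: "D > 0" "finite A"
      and T: "rescale (of_nat D) T
        = act (\<Sum>i\<in>A. Poly_Mapping.single (v i) (c i)) (corner_square 1)"
      using rational_tile_decomposition[OF rep rat] by blast
    have "translate 0 (rescale D T) = rescale D T" by (simp add: translate_def)
    then have "has_bochner_integral lborel (\<lambda>p. real_of_rat (rescale D T p))
        ((real D)\<^sup>2 * weighted_area T)"
      using has_integral_translate_rescale[OF area, of D 0] D(1) by simp
    \<comment> \<open>The integral of the enlarged tile is computed in two ways: by scaling the
      weighted area and by counting weighted unit cells.\<close>
    then have "real_of_rat (\<Sum>i\<in>A. c i) = (real D)\<^sup>2 * weighted_area T"
      using act_corner_square_integral[of v c A] unfolding T by (rule has_bochner_integral_eq[rotated])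
    then have "(\<Sum>i\<in>A. c i) \<noteq> 0" using nz D(1) by auto
    then obtain N :: nat where N: "N > 0" "shapetiles T (corner_square (of_nat N))"
      using shapetiles_corner_square[OF _ D(2) T] D(1) by auto
    have "square ({0..<real N} \<times> {0..<real N})"
      unfolding square_def using N(1) by (intro exI[of _ 0] exI[of _ "real N"]) auto
    with N(2) show "\<exists>S. square S \<and> shapetiles T (indicator S)"
      unfolding corner_square_def by blast
  qed
qed

end
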